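(* Let $g=2^n$ with $n\ge 4$ and let $a=2^{n-2}$. The number of exact factorizations of the quasidihedral (semidihedral) group $$SD_g=\langle x,y\mid x^{2a}=y^2=1,\ y^{-1}xy=x^{a-1}\rangle$$ is given by $f_2(SD_g)=2$.
   Context: An exact factorization of a finite group $G$ is a pair $(H,K)$ of subgroups of $G$ with $G=HK$ and $H\cap K=1$; in counting, only factorizations in which both $H$ and $K$ are nontrivial are considered. Two exact factorizations $(H,K)$ and $(L,M)$ of $G$ are equivalent if either $H\cong L$ and $K\cong M$, or $H\cong M$ and $K\cong L$ (abstract group isomorphisms). $f_2(G)$ denotes the number of equivalence classes of exact factorizations of $G$. *)

theory Defs
  imports "HOL-Algebra.Coset"
begin

datatype 'g letter = Gen 'g | Inv 'g

type_synonym 'g word = "'g letter list"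

text \<open>The congruence on words over the generators in type \<open>'g\<close> and their formal inverses
  generated by free cancellation and by the defining relations \<open>u = v\<close> for \<open>(u, v) \<in> R\<close>.\<close>

inductive word_eq :: "('g word \<times> 'g word) set \<Rightarrow> 'g word \<Rightarrow> 'g word \<Rightarrow> bool"
  for R where
  word_refl: "word_eq R u u"
| word_sym: "word_eq R u v \<Longrightarrow> word_eq R v u"
| word_trans: "word_eq R u v \<Longrightarrow> word_eq R v w \<Longrightarrow> word_eq R u w"
| word_append: "word_eq R u u' \<Longrightarrow> word_eq R v v' \<Longrightarrow> word_eq R (u @ v) (u' @ v')"
| word_cancel_right: "word_eq R [Gen g, Inv g] []"
| word_cancel_left: "word_eq R [Inv g, Gen g] []"
| word_relation: "(u, v) \<in> R \<Longrightarrow> word_eq R u v"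

definition word_rel :: "('g word \<times> 'g word) set \<Rightarrow> ('g word \<times> 'g word) set" where
  "word_rel R = {(u, v). word_eq R u v}"

text \<open>The group with presentation \<open>\<langle>'g | R\<rangle>\<close>; its elements are the congruence classes of words.\<close>

definition presented_group :: "('g word \<times> 'g word) set \<Rightarrow> 'g word set monoid" where
  "presented_group R =
     \<lparr>carrier = UNIV // word_rel R,
      mult = (\<lambda>A B. \<Union>u\<in>A. \<Union>v\<in>B. word_rel R `` {u @ v}),
      one = word_rel R `` {[]}\<rparr>"

lemma equiv_word_rel: "equiv UNIV (word_rel R)"
  by (rule equivI) (auto simp: word_rel_def refl_on_def sym_def trans_def
      intro: word_refl word_sym word_trans)

lemma presented_group_mult:
  "(word_rel R `` {u}) \<otimes>\<^bsub>presented_group R\<^esub> (word_rel R `` {v}) = word_rel R `` {u @ v}"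
proof -
  have "congruent2 (word_rel R) (word_rel R) (\<lambda>u v. word_rel R `` {u @ v})"
    by (rule congruent2I', rule equiv_class_eq[OF equiv_word_rel])
       (auto simp: word_rel_def intro: word_append)
  from UN_equiv_class2[OF equiv_word_rel equiv_word_rel this]
  show ?thesis by (simp add: presented_group_def)
qed

primrec inv_letter :: "'g letter \<Rightarrow> 'g letter" where
  "inv_letter (Gen g) = Inv g"
| "inv_letter (Inv g) = Gen g"

lemma word_eq_inverse: "word_eq R (rev (map inv_letter w) @ w) []"
proof (induction w)
  case Nil
  show ?case by (simp add: word_refl)
next
  case (Cons l w)
  have c: "word_eq R [inv_letter l, l] []"
    by (cases l) (auto intro: word_cancel_left word_cancel_right)
  have "word_eq R (rev (map inv_letter w) @ ([inv_letter l, l] @ w))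
          (rev (map inv_letter w) @ ([] @ w))"
    by (intro word_append word_refl c)
  with Cons show ?case by (auto intro: word_trans)
qed

lemma group_presented_group: "group (presented_group R)"
proof -
  have car: "\<exists>u. A = word_rel R `` {u}" if "A \<in> carrier (presented_group R)" for A
    using that by (auto simp: presented_group_def elim: quotientE)
  have mem: "word_rel R `` {u} \<in> carrier (presented_group R)" for u
    by (simp add: presented_group_def quotientI)
  have one: "\<one>\<^bsub>presented_group R\<^esub> = word_rel R `` {[]}"
    by (simp add: presented_group_def)
  show ?thesis
  proof (rule groupI)
    fix A assume "A \<in> carrier (presented_group R)"
    then obtain w where w: "A = word_rel R `` {w}" using car by blast
    have "word_rel R `` {rev (map inv_letter w) @ w} = word_rel R `` {[]}"
      by (rule equiv_class_eq[OF equiv_word_rel]) (simp add: word_rel_def word_eq_inverse)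
    then show "\<exists>B\<in>carrier (presented_group R). B \<otimes>\<^bsub>presented_group R\<^esub> A = \<one>\<^bsub>presented_group R\<^esub>"
      using mem by (auto simp: w one presented_group_mult intro!: bexI[of _ "word_rel R `` {rev (map inv_letter w)}"])
  qed (auto dest!: car simp: presented_group_mult mem one)
qed

datatype sd_gen = sd_x | sd_y

text \<open>\<open>\<langle>x, y | x^(2a) = y^2 = 1, y^(-1) x y = x^(a-1)\<rangle>\<close>; for \<open>a = 2^(n-2)\<close> with
  \<open>n \<ge> 4\<close> this is the quasidihedral (semidihedral) group of order \<open>4a = 2^n\<close>.\<close>

definition quasidihedral :: "nat \<Rightarrow> sd_gen word set monoid" where
  "quasidihedral a = presented_group
     {(replicate (2 * a) (Gen sd_x), []),
      (replicate 2 (Gen sd_y), []),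
      ([Inv sd_y, Gen sd_x, Gen sd_y], replicate (a - 1) (Gen sd_x))}"

definition exact_factorization :: "('a, 'b) monoid_scheme \<Rightarrow> 'a set \<Rightarrow> 'a set \<Rightarrow> bool" where
  "exact_factorization G H K \<longleftrightarrow>
     subgroup H G \<and> subgroup K G \<and> carrier G = H <#>\<^bsub>G\<^esub> K \<and> H \<inter> K = {\<one>\<^bsub>G\<^esub>}"

definition nontrivial_exact_factorizations :: "('a, 'b) monoid_scheme \<Rightarrow> ('a set \<times> 'a set) set" where
  "nontrivial_exact_factorizations G =
     {(H, K). exact_factorization G H K \<and> H \<noteq> {\<one>\<^bsub>G\<^esub>} \<and> K \<noteq> {\<one>\<^bsub>G\<^esub>}}"

definition factorization_equiv ::
    "('a, 'b) monoid_scheme \<Rightarrow> (('a set \<times> 'a set) \<times> ('a set \<times> 'a set)) set" where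
  "factorization_equiv G =
     {((H, K), (L, M)).
        (H, K) \<in> nontrivial_exact_factorizations G \<and>
        (L, M) \<in> nontrivial_exact_factorizations G \<and>
        ((G\<lparr>carrier := H\<rparr> \<cong> G\<lparr>carrier := L\<rparr> \<and> G\<lparr>carrier := K\<rparr> \<cong> G\<lparr>carrier := M\<rparr>) \<or>
         (G\<lparr>carrier := H\<rparr> \<cong> G\<lparr>carrier := M\<rparr> \<and> G\<lparr>carrier := K\<rparr> \<cong> G\<lparr>carrier := L\<rparr>))}"

text \<open>Only meaningful for finite \<open>G\<close>: \<open>card\<close> is \<open>0\<close> on infinite sets.\<close>

definition f2 :: "('a, 'b) monoid_scheme \<Rightarrow> nat" where
  "f2 G = card (nontrivial_exact_factorizations G // factorization_equiv G)"

end

(* The involution x^a lies in every nontrivial subgroup of <x>, and it is the square of x^i y for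
   odd i.  So a nontrivial subgroup avoiding x^a is generated by a reflection x^i y with i even, and
   one of the two factors must be of this form.  The other factor then has index 2 and contains no
   reflection of even index, which leaves only the cyclic group <x> and the generalized
   quaternion group <x^2, xy>; these are told apart by commutativity.  The normal form of elements
   is obtained by letting the group act on Z/2a by the affine maps t -> t + 1 and t -> (a - 1) t. *)

theory Submission
  imports Defs "HOL-Number_Theory.Cong"
begin

section \<open>Powers, factorizations and congruences\<close>

text \<open>Conjugation by \<open>y\<close> takes \<open>x\<close> to \<open>x'\<close>, hence
  powers to powers. Natural exponents go by induction, negative ones by cancelling the positive
  power. This will move the reflection past powers of the rotation.\<close>

lemma (in group) int_pow_commute_rel:
  assumes c: "x \<in> carrier G" "x' \<in> carrier G" "y \<in> carrier G" and yx: "y \<otimes> x = x' \<otimes> y"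
  shows "y \<otimes> x [^] (j::int) = x' [^] j \<otimes> y"
proof -
  have nat: "y \<otimes> x [^] k = x' [^] k \<otimes> y" for k :: nat
  proof (induction k)
    case (Suc k)
    have "y \<otimes> x [^] Suc k = (y \<otimes> x [^] k) \<otimes> x" using c by (simp add: m_assoc)
    also have "\<dots> = x' [^] k \<otimes> (y \<otimes> x)" using c by (simp add: Suc m_assoc)
    also have "\<dots> = x' [^] Suc k \<otimes> y" using c by (simp add: yx m_assoc)
    finally show ?case .
  qed (use c in simp)
  show ?thesis
  proof (cases j)
    case (nonneg k)
    then show ?thesis using nat[of k] by (simp add: int_pow_int)
  next
    case (neg k')
    define k where "k = Suc k'"
    have j: "j = - int k" by (simp only: neg k_def)
    have p: "x [^] j = inv (x [^] k)" "x' [^] j = inv (x' [^] k)"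
      using c by (simp_all only: j int_pow_neg_int)
    have cl: "x [^] k \<in> carrier G" "x' [^] k \<in> carrier G" using c by auto
    have "x' [^] k \<otimes> (y \<otimes> inv (x [^] k)) = x' [^] k \<otimes> y \<otimes> inv (x [^] k)"
      using c cl by (simp add: m_assoc)
    also have "\<dots> = y \<otimes> (x [^] k \<otimes> inv (x [^] k))"
      using c cl by (simp flip: nat add: m_assoc)
    also have "\<dots> = y" using c cl by simp
    finally have "inv (x' [^] k) \<otimes> y = y \<otimes> inv (x [^] k)"
      using c cl by (simp add: inv_solve_left')
    then show ?thesis by (simp add: p)
  qed
qed

text \<open>Inversion reverses products, so a decomposition of \<open>inv g\<close> in
  \<open>H <#> K\<close> yields one of \<open>g\<close> in \<open>K <#> H\<close>.\<close>

lemma (in group) exact_factorization_sym: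
  assumes "exact_factorization G H K"
  shows "exact_factorization G K H"
proof -
  have s: "subgroup H G" "subgroup K G" "carrier G = H <#> K" "H \<inter> K = {\<one>}"
    using assms by (auto simp: exact_factorization_def)
  have "g \<in> K <#> H" if g: "g \<in> carrier G" for g
  proof -
    obtain h k where hk: "h \<in> H" "k \<in> K" "inv g = h \<otimes> k"
      using g s(3) inv_closed[OF g] by (auto simp: set_mult_def)
    have "h \<in> carrier G" "k \<in> carrier G" using hk s by (auto dest: subgroup.mem_carrier)
    then have "g = inv k \<otimes> inv h" using hk g by (metis inv_inv inv_mult_group)
    moreover have "inv k \<in> K" "inv h \<in> H" using hk s by (auto intro: subgroup.m_inv_closed)
    ultimately show ?thesis by (auto simp: set_mult_def)
  qed
  moreover have "K <#> H \<subseteq> carrier G" using s by (meson set_mult_closed subgroup.subset)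
  ultimately show ?thesis using s by (auto simp: exact_factorization_def)
qed

text \<open>In the cyclic group of order \<open>2 ^ Suc m\<close> every nontrivial element has the
  involution as a multiple. An even \<open>i\<close> is halved, which lowers \<open>m\<close> by
  one; for odd \<open>i\<close> the choice \<open>j = 2 ^ m\<close> works, since
  \<open>2 ^ m * (i - 1)\<close> is divisible by \<open>2 ^ Suc m\<close>.\<close>

lemma odd_times_half_cong:
  fixes i :: int
  assumes "\<not> 2 ^ Suc m dvd i"
  shows "\<exists>j::nat. [i * int j = 2 ^ m] (mod 2 ^ Suc m)"
  using assms
proof (induction m arbitrary: i)
  case 0
  then have "[i * int 1 = 2 ^ 0] (mod 2 ^ Suc 0)" by (auto simp: cong_def odd_iff_mod_2_eq_one)
  then show ?case by blast
next
  case (Suc m)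
  show ?case
  proof (cases "even i")
    case True
    then obtain i' where i': "i = 2 * i'" by blast
    with Suc.prems have "\<not> 2 ^ Suc m dvd i'" by auto
    from Suc.IH[OF this] obtain j where "[i' * int j = 2 ^ m] (mod 2 ^ Suc m)" by blast
    then have "[i * int j = 2 ^ Suc m] (mod 2 ^ Suc (Suc m))"
      unfolding i' cong_iff_dvd_diff
      using mult_dvd_mono[of 2 2 "2 ^ Suc m" "i' * int j - 2 ^ m"] by (simp add: algebra_simps)
    then show ?thesis by blast
  next
    case False
    then obtain k where k: "i = 2 * k + 1" by (elim oddE)
    have "i * int (2 ^ Suc m) - 2 ^ Suc m = 2 ^ Suc (Suc m) * k" by (simp add: k algebra_simps)
    then have "[i * int (2 ^ Suc m) = 2 ^ Suc m] (mod 2 ^ Suc (Suc m))"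
      unfolding cong_iff_dvd_diff by (metis dvd_triv_left)
    then show ?thesis by blast
  qed
qed

text \<open>The classes are the two fibres of \<open>f\<close>; \<open>p\<close> and
  \<open>q\<close> show that both are nonempty.\<close>

lemma card_quotient_bool_invariant:
  assumes "p \<in> N" "f p" "q \<in> N" "\<not> f q"
  shows "card (N // {(u, v). u \<in> N \<and> v \<in> N \<and> f u = f v}) = 2"
proof -
  have "N // {(u, v). u \<in> N \<and> v \<in> N \<and> f u = f v} = {{u \<in> N. f u}, {u \<in> N. \<not> f u}}"
    using assms by (fastforce simp: quotient_def Image_def)
  moreover have "{u \<in> N. f u} \<noteq> {u \<in> N. \<not> f u}" using assms by blast
  ultimately show ?thesis by simp
qed

section \<open>Commutativity as an isomorphism invariant\<close>

definition commutative_on :: "('a, 'b) monoid_scheme \<Rightarrow> 'a set \<Rightarrow> bool" where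
  "commutative_on G H \<longleftrightarrow> (\<forall>u\<in>H. \<forall>v\<in>H. u \<otimes>\<^bsub>G\<^esub> v = v \<otimes>\<^bsub>G\<^esub> u)"

text \<open>Commutativity passes to homomorphic images; the isomorphism and its inverse give the two
  directions.\<close>

lemma (in group) iso_commutative_on:
  assumes "subgroup H G" "subgroup K G" and iso: "G\<lparr>carrier := H\<rparr> \<cong> G\<lparr>carrier := K\<rparr>"
  shows "commutative_on G H \<longleftrightarrow> commutative_on G K"
proof -
  have imp: "commutative_on G B" if AB: "G\<lparr>carrier := A\<rparr> \<cong> G\<lparr>carrier := B\<rparr>" "commutative_on G A" for A B
  proof -
    obtain f where f: "f \<in> hom (G\<lparr>carrier := A\<rparr>) (G\<lparr>carrier := B\<rparr>)" "f ` A = B"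
      using AB(1) by (auto simp: is_iso_def iso_def bij_betw_def)
    then have hom: "f (u \<otimes> v) = f u \<otimes> f v" if "u \<in> A" "v \<in> A" for u v
      using that by (auto simp: hom_def)
    have "f u \<otimes> f v = f v \<otimes> f u" if "u \<in> A" "v \<in> A" for u v
      using hom[OF that] hom[OF that(2,1)] AB(2) that by (simp add: commutative_on_def)
    then show ?thesis using f(2) by (auto simp: commutative_on_def)
  qed
  have "G\<lparr>carrier := K\<rparr> \<cong> G\<lparr>carrier := H\<rparr>"
    using iso group.iso_sym[OF subgroup_imp_group[OF assms(1)]] by blast
  then show ?thesis using imp assms by blast
qed

section \<open>Subgroups avoiding the central involution\<close>

text \<open>\<open>e i b\<close> plays the role of \<open>x\<^sup>i\<close> for \<open>b = False\<close> and of \<open>x\<^sup>i y\<close> for \<open>b = True\<close>.\<close>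

locale semidihedral = group G for G (structure) +
  fixes m :: nat and a :: int and e :: "int \<Rightarrow> bool \<Rightarrow> 'a"
  assumes m: "m \<ge> 2" and a_def: "a = 2 ^ m"
    and carrier_e: "carrier G = (\<Union>i b. {e i b})"
    and mult_e: "e i b \<otimes> e j c = e (i + (if b then (a - 1) * j else j)) (b \<noteq> c)"
    and e_eq_iff: "e i b = e j c \<longleftrightarrow> b = c \<and> [i = j] (mod 2 * a)"
begin

lemma a_facts: "a \<ge> 4" "even a"
proof -
  obtain k where k: "m = k + 2" using m by (metis add.commute le_Suc_ex)
  show "a \<ge> 4" "even a" by (auto simp: a_def k)
qed

lemma e_closed [simp]: "e i b \<in> carrier G"
  by (auto simp: carrier_e)

lemma carrierE: assumes "g \<in> carrier G" obtains i b where "g = e i b"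
  using assms by (auto simp: carrier_e)

lemma one_e: "\<one> = e 0 False"
proof -
  have "e 0 False \<otimes> e 0 False = e 0 False" by (simp add: mult_e)
  then show ?thesis by (metis e_closed l_cancel_one)
qed

text \<open>The index is \<open>i + (a - 1) * i\<close>. With \<open>e_a_times\<close>, reflections
  of even index are involutions and those of odd index have square \<open>e a False\<close>.\<close>

lemma square_e_True: "e i True \<otimes> e i True = e (a * i) False"
  by (simp add: mult_e algebra_simps)

lemma e_a_times:
  shows "even i \<Longrightarrow> e (a * i) False = \<one>" and "odd i \<Longrightarrow> e (a * i) False = e a False"
proof -
  show "e (a * i) False = \<one>" if "even i"
    using that by (auto simp: one_e e_eq_iff cong_iff_dvd_diff)
  show "e (a * i) False = e a False" if "odd i"
  proof -
    from that obtain k where "i = 2 * k + 1" by (elim oddE)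
    then have "a * i - a = 2 * a * k" by (simp add: algebra_simps)
    then show ?thesis by (simp add: e_eq_iff cong_iff_dvd_diff)
  qed
qed

lemma mult_multiple_mem:
  assumes "subgroup H G" "e i False \<in> H"
  shows "e (i * int j) False \<in> H"
proof (induction j)
  case 0
  then show ?case using assms by (simp add: subgroup.one_closed flip: one_e)
next
  case (Suc j)
  then show ?case using subgroup.m_closed[OF assms(1) Suc assms(2)]
    by (simp add: mult_e algebra_simps)
qed

text \<open>Nontriviality says that \<open>2 * a = 2 ^ Suc m\<close> does not divide
  \<open>i\<close>, so \<open>odd_times_half_cong\<close> provides a power of
  \<open>e i False\<close> equal to \<open>e a False\<close>.\<close>

lemma central_involution_mem:
  assumes "subgroup H G" "e i False \<in> H" "e i False \<noteq> \<one>"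
  shows "e a False \<in> H"
proof -
  have "\<not> 2 ^ Suc m dvd i" using assms(3) by (simp add: one_e e_eq_iff cong_iff_dvd_diff a_def)
  then obtain j where "[i * int j = 2 ^ m] (mod 2 ^ Suc m)" using odd_times_half_cong by blast
  then have "e (i * int j) False = e a False" by (simp add: e_eq_iff a_def)
  then show ?thesis using mult_multiple_mem[OF assms(1,2), of j] by simp
qed

text \<open>Such an \<open>H\<close> contains no nontrivial power of x and no reflection of odd
  index. The product of two of its reflections is a power of x, hence trivial, which forces them to
  coincide.\<close>

lemma subgroup_without_central_involution:
  assumes H: "subgroup H G" "H \<noteq> {\<one>}" "e a False \<notin> H"
  shows "\<exists>i. even i \<and> H = {\<one>, e i True}"
proof -
  have cyc: "e j False = \<one>" if "e j False \<in> H" for j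
    using central_involution_mem[OF H(1) that] H(3) by blast
  have ev: "even j" if "e j True \<in> H" for j
    using subgroup.m_closed[OF H(1) that that] H(3) e_a_times(2) by (metis square_e_True)
  have "\<exists>g\<in>H. g \<noteq> \<one>" using H(1,2) subgroup.one_closed by blast
  then obtain g where g: "g \<in> H" "g \<noteq> \<one>" by blast
  obtain i b where gi: "g = e i b" using g H(1) by (meson carrierE subgroup.mem_carrier)
  with cyc g have b: b by (cases b) auto
  with gi g have iH: "e i True \<in> H" by simp
  have same: "e j True = e i True" if j: "e j True \<in> H" for j
  proof -
    have "e j True \<otimes> e i True = e (j + (a - 1) * i) False" by (simp add: mult_e)
    then have "e (j + (a - 1) * i) False = e 0 False"
      using cyc subgroup.m_closed[OF H(1) j iH] by (simp add: one_e)
    then have "2 * a dvd (j - i) + a * i" by (simp add: e_eq_iff cong_iff_dvd_diff algebra_simps)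
    moreover have "2 * a dvd a * i" using ev[OF iH] by auto
    ultimately have "2 * a dvd j - i" by (metis dvd_add_left_iff)
    then show ?thesis by (simp add: e_eq_iff cong_iff_dvd_diff)
  qed
  have "h = \<one> \<or> h = e i True" if h: "h \<in> H" for h
  proof -
    obtain j c where "h = e j c" using carrierE[OF subgroup.mem_carrier[OF H(1) h]] by blast
    with cyc same h show ?thesis by (cases c) auto
  qed
  then have "H = {\<one>, e i True}" using iH H(1) subgroup.one_closed by blast
  then show ?thesis using ev[OF iH] by blast
qed

section \<open>The two complements of a reflection\<close>

definition cyclic_part :: "'a set" where "cyclic_part = {e j False | j. True}"

text \<open>This is the generalized quaternion subgroup generated by x^2 and xy. The disequation
  acts as an exclusive or: even powers of x, and reflections of odd index.\<close>

definition quaternion_part :: "'a set" where "quaternion_part = {e j b | j b. even j \<noteq> b}"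

lemma e_mem_cyclic_part: "e j b \<in> cyclic_part \<longleftrightarrow> \<not> b"
  by (auto simp: cyclic_part_def e_eq_iff intro: cong_refl)

text \<open>Indices are determined only modulo \<open>2 * a\<close>; as this is even, their parity
  is well defined.\<close>

lemma e_mem_quaternion_part: "e j b \<in> quaternion_part \<longleftrightarrow> even j \<noteq> b"
proof -
  have "even j \<longleftrightarrow> even k" if "[j = k] (mod 2 * a)" for k
    using that by (metis cong_dvd_iff dvd_triv_left cong_dvd_modulus)
  then show ?thesis unfolding quaternion_part_def mem_Collect_eq e_eq_iff using cong_refl by blast
qed

lemma carrier_subset_eqI:
  assumes "A \<subseteq> carrier G" "B \<subseteq> carrier G" "\<And>i b. e i b \<in> A \<longleftrightarrow> e i b \<in> B"
  shows "A = B"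
proof -
  have "g \<in> A \<longleftrightarrow> g \<in> B" if "g \<in> carrier G" for g
    using that assms(3) by (metis carrierE)
  then show ?thesis using assms(1,2) by blast
qed

text \<open>\<open>K\<close> has index 2, so it is the kernel of a homomorphism onto a group of
  order 2; this is what \<open>mult_K\<close> expresses. The homomorphism is nontrivial on the
  reflection, so its value on x determines it, and the two possible values give the two
  subgroups.\<close>

lemma complement_of_reflection:
  assumes i: "even i" and ef: "exact_factorization G {\<one>, e i True} K"
  shows "K = cyclic_part \<or> K = quaternion_part"
proof -
  define h where "h = e i True"
  have K: "subgroup K G" and cov: "carrier G = {\<one>, h} <#> K" and int: "{\<one>, h} \<inter> K = {\<one>}"
    using ef by (auto simp: exact_factorization_def h_def)
  have hc: "h \<in> carrier G" by (simp add: h_def)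
  have hh: "h \<otimes> h = \<one>" using i by (simp add: h_def square_e_True e_a_times)
  have "h \<noteq> \<one>" by (simp add: h_def one_e e_eq_iff)
  then have hK: "h \<notin> K" using int by blast
  note sub = subgroup.mem_carrier[OF K] subgroup.m_closed[OF K] subgroup.m_inv_closed[OF K]
  \<comment> \<open>Left multiplication by \<open>h\<close> exchanges \<open>K\<close> and its
    complement.\<close>
  have hg: "h \<otimes> g \<in> K \<longleftrightarrow> g \<notin> K" if g: "g \<in> carrier G" for g
  proof
    assume "h \<otimes> g \<in> K"
    show "g \<notin> K"
    proof
      assume "g \<in> K"
      then have "(h \<otimes> g) \<otimes> inv g \<in> K" using \<open>h \<otimes> g \<in> K\<close> sub by blast
      then show False using g hc hK by (simp add: m_assoc)
    qed
  next
    assume "g \<notin> K"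
    have "g \<in> {\<one>, h} <#> K" using g cov by blast
    then obtain u k where "u \<in> {\<one>, h}" "k \<in> K" "g = u \<otimes> k"
      unfolding set_mult_def by blast
    moreover from this have "u \<noteq> \<one>" using \<open>g \<notin> K\<close> sub by auto
    ultimately have "k \<in> K" "g = h \<otimes> k" by auto
    moreover have "h \<otimes> (h \<otimes> k) = k" using hc hh sub(1)[OF \<open>k \<in> K\<close>] by (simp flip: m_assoc)
    ultimately have "h \<otimes> g = k" by simp
    then show "h \<otimes> g \<in> K" using \<open>k \<in> K\<close> by simp
  qed
  have left: "k \<otimes> g \<in> K \<longleftrightarrow> g \<in> K" if k: "k \<in> K" and g: "g \<in> carrier G" for k g
  proof
    assume "k \<otimes> g \<in> K"
    then have "inv k \<otimes> (k \<otimes> g) \<in> K" using k sub by blast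
    moreover have "inv k \<otimes> (k \<otimes> g) = g" using k g sub(1) by (simp flip: m_assoc)
    ultimately show "g \<in> K" by simp
  qed (use k sub in blast)
  have mult_K: "u \<otimes> v \<in> K \<longleftrightarrow> (u \<in> K \<longleftrightarrow> v \<in> K)" if u: "u \<in> carrier G" and v: "v \<in> carrier G" for u v
  proof (cases "u \<in> K")
    case True
    then show ?thesis using left v by simp
  next
    case False
    \<comment> \<open>Replacing \<open>u\<close> by \<open>h \<otimes> u\<close> leads back to the
      first case and flips membership of the product once.\<close>
    then have "h \<otimes> u \<in> K" using hg u by simp
    then have "(h \<otimes> u) \<otimes> v \<in> K \<longleftrightarrow> v \<in> K" using left v by simp
    then have "u \<otimes> v \<notin> K \<longleftrightarrow> v \<in> K" using hg[of "u \<otimes> v"] u v hc by (simp add: m_assoc)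
    then show ?thesis using False by blast
  qed
  have nat: "e (int k) False \<in> K \<longleftrightarrow> e 1 False \<in> K \<or> even k" for k
  proof (induction k)
    case 0
    show ?case using subgroup.one_closed[OF K] by (simp add: one_e)
  next
    case (Suc k)
    have "e (int (Suc k)) False = e 1 False \<otimes> e (int k) False" by (simp add: mult_e)
    then show ?case using mult_K[of "e 1 False" "e (int k) False"] Suc by auto
  qed
  have cyc: "e j False \<in> K \<longleftrightarrow> e 1 False \<in> K \<or> even j" for j
  proof -
    \<comment> \<open>Reduction modulo the even number \<open>2 * a\<close> keeps the parity and
      gives a natural exponent, to which \<open>nat\<close> applies.\<close>
    have "even (j mod (2 * a)) \<longleftrightarrow> even j" by (metis dvd_mod_iff dvd_triv_left)
    moreover have "e j False = e (int (nat (j mod (2 * a)))) False"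
      using a_facts by (simp add: e_eq_iff cong_def)
    ultimately show ?thesis using nat[of "nat (j mod (2 * a))"] a_facts
      by (simp add: even_nat_iff)
  qed
  have refl: "e j True \<in> K \<longleftrightarrow> e 1 False \<notin> K \<and> odd j" for j
  proof -
    \<comment> \<open>As \<open>i\<close> is even, \<open>j - i\<close> has the parity of
      \<open>j\<close>; the factor \<open>h\<close> outside \<open>K\<close> negates
      membership.\<close>
    have "e j True = e (j - i) False \<otimes> h" by (simp add: h_def mult_e)
    then show ?thesis using mult_K[of "e (j - i) False" h] hc hK cyc[of "j - i"] i by auto
  qed
  define P where "P = (if e 1 False \<in> K then cyclic_part else quaternion_part)"
  have "K = P"
  proof (rule carrier_subset_eqI)
    show "K \<subseteq> carrier G" by (rule subgroup.subset[OF K])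
    show "P \<subseteq> carrier G" by (auto simp: P_def cyclic_part_def quaternion_part_def)
    show "e j b \<in> K \<longleftrightarrow> e j b \<in> P" for j b
      using cyc[of j] refl[of j]
      by (cases b) (simp_all add: P_def e_mem_cyclic_part e_mem_quaternion_part)
  qed
  then show ?thesis by (metis P_def)
qed

text \<open>A reflection has square \<open>e (a * i) False\<close>, so its inverse is the reflection
  shifted by \<open>- a * i\<close>.\<close>

lemma inv_e: "inv (e i b) = e (if b then i - a * i else - i) b"
  by (rule inv_equality) (auto simp: mult_e one_e algebra_simps)

lemma subgroup_cyclic_part: "subgroup cyclic_part G"
  by (rule subgroupI) (auto simp: cyclic_part_def inv_e mult_e)

lemma subgroup_quaternion_part: "subgroup quaternion_part G"
proof (rule subgroupI)
  show "quaternion_part \<noteq> {}" by (auto simp: quaternion_part_def)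
  show "inv u \<in> quaternion_part" if u: "u \<in> quaternion_part" for u
  proof -
    from u obtain j b where "u = e j b" "even j \<noteq> b" by (auto simp: quaternion_part_def)
    then show ?thesis using a_facts by (simp add: inv_e e_mem_quaternion_part)
  qed
  show "u \<otimes> v \<in> quaternion_part" if uv: "u \<in> quaternion_part" "v \<in> quaternion_part" for u v
  proof -
    from uv obtain i b j c where "u = e i b" "even i \<noteq> b" "v = e j c" "even j \<noteq> c"
      by (auto simp: quaternion_part_def)
    then show ?thesis using a_facts by (auto simp: mult_e e_mem_quaternion_part)
  qed
qed (auto simp: quaternion_part_def)

lemma commutative_cyclic_part: "commutative_on G cyclic_part"
  by (auto simp: commutative_on_def cyclic_part_def mult_e add.commute)

lemma commutative_reflection: "commutative_on G {\<one>, e i True}"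
  by (auto simp: commutative_on_def)

lemma not_commutative_quaternion_part: "\<not> commutative_on G quaternion_part"
proof
  assume "commutative_on G quaternion_part"
  moreover have "e 1 True \<in> quaternion_part" "e 2 False \<in> quaternion_part"
    by (simp_all add: e_mem_quaternion_part)
  ultimately have "e 1 True \<otimes> e 2 False = e 2 False \<otimes> e 1 True"
    unfolding commutative_on_def by blast
  \<comment> \<open>The two products are reflections of index \<open>1 + (a - 1) * 2\<close> and
    \<open>3\<close>.\<close>
  then have "2 * a dvd 2 * a - 4" by (simp add: mult_e e_eq_iff cong_iff_dvd_diff algebra_simps)
  then have "2 * a dvd 4" by (metis dvd_diff_right_iff dvd_refl)
  then show False using zdvd_imp_le[of "2 * a" 4] a_facts by simp
qed

section \<open>Classification and count of the factorizations\<close>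

text \<open>Both groups have order 2. Thus the index of the reflection does not affect the
  equivalence class of a factorization.\<close>

lemma iso_reflections:
  "G\<lparr>carrier := {\<one>, e i True}\<rparr> \<cong> G\<lparr>carrier := {\<one>, e j True}\<rparr>" if "even i" "even j"
proof (rule is_isoI)
  have ne: "e k True \<noteq> \<one>" for k by (simp add: one_e e_eq_iff)
  have sq: "e i True \<otimes> e i True = \<one>" "e j True \<otimes> e j True = \<one>"
    using that by (simp_all add: square_e_True e_a_times)
  show "(\<lambda>u. if u = \<one> then \<one> else e j True) \<in>
      iso (G\<lparr>carrier := {\<one>, e i True}\<rparr>) (G\<lparr>carrier := {\<one>, e j True}\<rparr>)"
    using ne[of i] ne[of j] ne[of j, symmetric] sq
    by (auto simp: iso_def hom_def bij_betw_def inj_on_def)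
qed

text \<open>Multiplication by y keeps the parity of the index, because \<open>a - 1\<close> is odd,
  and toggles the reflection flag. Hence it carries the complement of \<open>P\<close> into
  \<open>P\<close>. These pairs represent the two classes.\<close>

lemma exact_factorization_reflection:
  assumes P: "P = cyclic_part \<or> P = quaternion_part"
  shows "exact_factorization G {\<one>, e 0 True} P"
proof -
  define h where "h = e 0 True"
  have hc: "h \<in> carrier G" and hh: "h \<otimes> h = \<one>" and hinv: "inv h = h"
    by (simp_all add: h_def mult_e one_e inv_e)
  have H: "subgroup {\<one>, h} G"
    by (rule subgroupI) (use hc hh hinv in auto)
  have K: "subgroup P G" using P subgroup_cyclic_part subgroup_quaternion_part by blast
  have hP: "h \<notin> P" using P by (auto simp: h_def e_mem_cyclic_part e_mem_quaternion_part)
  have "h \<otimes> g \<in> P" if g: "g \<in> carrier G" "g \<notin> P" for g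
  proof -
    obtain j b where gj: "g = e j b" using g carrierE by blast
    then have "h \<otimes> g = e ((a - 1) * j) (\<not> b)" by (simp add: h_def mult_e)
    moreover have "even ((a - 1) * j) \<longleftrightarrow> even j" using a_facts by simp
    ultimately show ?thesis using P g(2) gj by (auto simp: e_mem_cyclic_part e_mem_quaternion_part)
  qed
  then have "\<exists>u\<in>{\<one>, h}. \<exists>k\<in>P. g = u \<otimes> k" if g: "g \<in> carrier G" for g
  proof (cases "g \<in> P")
    case False
    moreover have "g = h \<otimes> (h \<otimes> g)" using g hc hh by (simp flip: m_assoc)
    ultimately show ?thesis using g \<open>\<And>g. g \<in> carrier G \<Longrightarrow> g \<notin> P \<Longrightarrow> h \<otimes> g \<in> P\<close> by blast
  next
    case True
    moreover have "g = \<one> \<otimes> g" using g by simp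
    ultimately show ?thesis by blast
  qed
  then have "carrier G \<subseteq> {\<one>, h} <#> P" unfolding set_mult_def by blast
  moreover have "{\<one>, h} <#> P \<subseteq> carrier G"
    using H K by (meson set_mult_closed subgroup.subset)
  ultimately show ?thesis unfolding exact_factorization_def h_def[symmetric]
    using H K hP subgroup.one_closed[OF K] by blast
qed

text \<open>The trivial intersection keeps \<open>e a False\<close> out of one factor, which is then
  generated by a reflection; exchanging the factors reduces the second case to
  \<open>complement_of_reflection\<close>.\<close>

lemma factorization_cases:
  assumes "(H, K) \<in> nontrivial_exact_factorizations G"
  obtains i P where "even i" "P = cyclic_part \<or> P = quaternion_part"
    "(H = {\<one>, e i True} \<and> K = P) \<or> (H = P \<and> K = {\<one>, e i True})"
proof -
  have ef: "exact_factorization G H K" and nt: "H \<noteq> {\<one>}" "K \<noteq> {\<one>}"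
    using assms by (auto simp: nontrivial_exact_factorizations_def)
  then have sub: "subgroup H G" "subgroup K G" "H \<inter> K = {\<one>}"
    by (auto simp: exact_factorization_def)
  have "\<not> 2 * a dvd a" using a_facts zdvd_imp_le[of "2 * a" a] by auto
  then have "e a False \<noteq> \<one>" by (simp add: one_e e_eq_iff cong_iff_dvd_diff)
  then consider "e a False \<notin> H" | "e a False \<notin> K" using sub(3) by blast
  then show ?thesis
  proof cases
    case 1
    then obtain i where "even i" "H = {\<one>, e i True}"
      using subgroup_without_central_involution sub(1) nt(1) by blast
    moreover from this have "K = cyclic_part \<or> K = quaternion_part"
      using complement_of_reflection ef by simp
    ultimately show ?thesis using that by metis
  next
    case 2
    then obtain i where "even i" "K = {\<one>, e i True}"
      using subgroup_without_central_involution sub(2) nt(2) by blast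
    moreover from this have "H = cyclic_part \<or> H = quaternion_part"
      using complement_of_reflection exact_factorization_sym[OF ef] by simp
    ultimately show ?thesis using that by metis
  qed
qed

text \<open>The invariant \<open>f\<close> is symmetric in the two factors, so it respects both
  alternatives of the equivalence. Since the reflection factor is commutative, \<open>f\<close>
  tests the other factor only, and thereby decides whether that one is cyclic or quaternion.\<close>

lemma factorization_equiv_eq:
  defines "N \<equiv> nontrivial_exact_factorizations G"
    and "f \<equiv> \<lambda>(H, K). commutative_on G H \<and> commutative_on G K"
  shows "factorization_equiv G = {(u, v). u \<in> N \<and> v \<in> N \<and> f u = f v}"
proof -
  have "((H, K), (L, M)) \<in> factorization_equiv G \<longleftrightarrow> f (H, K) = f (L, M)"
    if HK: "(H, K) \<in> N" and LM: "(L, M) \<in> N" for H K L M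
  proof
    assume equiv: "((H, K), (L, M)) \<in> factorization_equiv G"
    have "subgroup H G" "subgroup K G" "subgroup L G" "subgroup M G"
      using HK LM by (auto simp: N_def nontrivial_exact_factorizations_def exact_factorization_def)
    then have "G\<lparr>carrier := A\<rparr> \<cong> G\<lparr>carrier := B\<rparr> \<Longrightarrow> commutative_on G A = commutative_on G B"
      if "A \<in> {H, K}" "B \<in> {L, M}" for A B
      using that iso_commutative_on by blast
    with equiv show "f (H, K) = f (L, M)"
      unfolding factorization_equiv_def f_def by auto
  next
    assume eq: "f (H, K) = f (L, M)"
    obtain i P where HK': "even i" "P = cyclic_part \<or> P = quaternion_part"
      "(H = {\<one>, e i True} \<and> K = P) \<or> (H = P \<and> K = {\<one>, e i True})"
      using factorization_cases HK N_def by metis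
    obtain j Q where LM': "even j" "Q = cyclic_part \<or> Q = quaternion_part"
      "(L = {\<one>, e j True} \<and> M = Q) \<or> (L = Q \<and> M = {\<one>, e j True})"
      using factorization_cases LM N_def by metis
    have "f (H, K) = commutative_on G P" "f (L, M) = commutative_on G Q"
      using HK'(3) LM'(3) commutative_reflection by (auto simp: f_def)
    then have "P = Q"
      using eq HK'(2) LM'(2) commutative_cyclic_part not_commutative_quaternion_part by auto
    then show "((H, K), (L, M)) \<in> factorization_equiv G"
      using HK LM HK'(1,3) LM'(1,3) iso_reflections[of i j] iso_refl
      unfolding factorization_equiv_def N_def by auto
  qed
  moreover have "factorization_equiv G \<subseteq> N \<times> N"
    by (auto simp: factorization_equiv_def N_def)
  ultimately show ?thesis by auto
qed

lemma f2_eq_2: "f2 G = 2"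
proof -
  let ?N = "nontrivial_exact_factorizations G"
  let ?f = "\<lambda>(H, K). commutative_on G H \<and> commutative_on G K"
  let ?T = "{\<one>, e 0 True}"
  have ne: "?T \<noteq> {\<one>}" "cyclic_part \<noteq> {\<one>}" "quaternion_part \<noteq> {\<one>}"
  proof -
    show "?T \<noteq> {\<one>}" by (auto simp: one_e e_eq_iff)
    have "\<not> 2 * a dvd 1" using a_facts by auto
    then have "e 1 False \<noteq> \<one>" by (simp add: one_e e_eq_iff cong_iff_dvd_diff)
    then show "cyclic_part \<noteq> {\<one>}" by (auto simp: cyclic_part_def)
    show "quaternion_part \<noteq> {\<one>}"
      using not_commutative_quaternion_part by (auto simp: commutative_on_def)
  qed
  have "(?T, cyclic_part) \<in> ?N" "(?T, quaternion_part) \<in> ?N"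
    using ne exact_factorization_reflection by (auto simp: nontrivial_exact_factorizations_def)
  moreover have "?f (?T, cyclic_part)" "\<not> ?f (?T, quaternion_part)"
    using commutative_reflection commutative_cyclic_part not_commutative_quaternion_part by auto
  ultimately show ?thesis
    unfolding f2_def factorization_equiv_eq
    using card_quotient_bool_invariant[of "(?T, cyclic_part)" ?N ?f "(?T, quaternion_part)"] by blast
qed

end

section \<open>Affine action of words modulo \<open>2 * a\<close>\<close>

text \<open>Both generators act as affine maps modulo \<open>2a\<close>; \<open>y\<close> is its own inverse there because
  \<open>(a - 1)\<^sup>2 = 1\<close> modulo \<open>2a\<close> for even \<open>a\<close>.\<close>

fun letter_act :: "int \<Rightarrow> sd_gen letter \<Rightarrow> int \<Rightarrow> int" where
  "letter_act a (Gen sd_x) t = t + 1"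
| "letter_act a (Inv sd_x) t = t - 1"
| "letter_act a (Gen sd_y) t = (a - 1) * t"
| "letter_act a (Inv sd_y) t = (a - 1) * t"

definition word_act :: "int \<Rightarrow> sd_gen word \<Rightarrow> int \<Rightarrow> int" where
  "word_act a w t = foldr (letter_act a) w t"

lemma word_act_simps [simp]:
  "word_act a [] t = t"
  "word_act a (l # w) t = letter_act a l (word_act a w t)"
  "word_act a (u @ v) t = word_act a u (word_act a v t)"
  by (simp_all add: word_act_def)

lemma word_act_replicate_x [simp]: "word_act a (replicate k (Gen sd_x)) t = t + int k"
  by (induction k) auto

lemma letter_act_cong:
  "[s = t] (mod N) \<Longrightarrow> [letter_act a l s = letter_act a l t] (mod N)"
  by (induction a l s rule: letter_act.induct) (auto intro: cong_add cong_diff cong_mult)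

lemma word_act_cong:
  "[s = t] (mod N) \<Longrightarrow> [word_act a w s = word_act a w t] (mod N)"
  by (induction w) (auto intro: letter_act_cong)

text \<open>The difference is \<open>a * (a - 2) * t\<close>, and \<open>a - 2\<close> is
  even.\<close>

lemma reflection_twice_cong:
  fixes a :: int
  assumes "even a"
  shows "[(a - 1) * ((a - 1) * t) = t] (mod 2 * a)"
proof -
  from assms obtain k where "a = 2 * k" by blast
  then have "(a - 1) * ((a - 1) * t) - t = 2 * a * ((k - 1) * t)" by (simp add: algebra_simps)
  then show ?thesis by (simp add: cong_iff_dvd_diff)
qed

text \<open>A name for the relation set written out in \<open>quasidihedral\<close>.\<close>

definition quasidihedral_relations :: "nat \<Rightarrow> (sd_gen word \<times> sd_gen word) set" where
  "quasidihedral_relations a =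
     {(replicate (2 * a) (Gen sd_x), []),
      (replicate 2 (Gen sd_y), []),
      ([Inv sd_y, Gen sd_x, Gen sd_y], replicate (a - 1) (Gen sd_x))}"

text \<open>The affine maps satisfy the defining relations, so equal group elements act equally;
  this later separates normal forms. Allowing two congruent starting points \<open>s\<close> and
  \<open>t\<close> lets the induction hypotheses compose in the case of concatenation.\<close>

lemma word_eq_act_cong:
  assumes a: "even a" "a > 0" and "word_eq (quasidihedral_relations a) u v"
    and "[s = t] (mod 2 * int a)"
  shows "[word_act (int a) u s = word_act (int a) v t] (mod 2 * int a)"
  using assms(3,4)
proof (induction arbitrary: s t)
  case (word_refl u)
  then show ?case by (rule word_act_cong)
next
  case (word_sym u v)
  then show ?case using cong_sym by blast
next
  case (word_trans u v w)
  then show ?case using cong_trans cong_refl by blast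
next
  case (word_append u u' v v')
  then show ?case by simp
next
  case (word_cancel_right g)
  then show ?case using cong_trans[OF reflection_twice_cong] a by (cases g) auto
next
  case (word_cancel_left g)
  then show ?case using cong_trans[OF reflection_twice_cong] a by (cases g) auto
next
  case (word_relation u v)
  have tw: "[(int a - 1) * ((int a - 1) * s) = t] (mod 2 * int a)"
    using cong_trans[OF reflection_twice_cong word_relation(2)] a by simp
  have "[s + 2 * int a = t] (mod 2 * int a)"
    using word_relation(2) by (simp add: cong_def)
  \<comment> \<open>This is the conjugation relation: the left side is the action of y^(-1) x y, and
    multiplying out leaves a translation by \<open>a - 1\<close>.\<close>
  moreover have "[(int a - 1) * ((int a - 1) * s + 1) = t + int (a - 1)] (mod 2 * int a)"
    using cong_add[OF tw cong_refl[of "int a - 1"]] a by (simp add: algebra_simps of_nat_diff)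
  ultimately show ?case using word_relation(1) tw
    by (auto simp: quasidihedral_relations_def numeral_2_eq_2)
qed

section \<open>Normal forms in the presented group\<close>

context
  fixes a :: nat and G :: "sd_gen word set monoid" and X Y :: "sd_gen word set"
    and cl :: "sd_gen word \<Rightarrow> sd_gen word set" and e :: "int \<Rightarrow> bool \<Rightarrow> sd_gen word set"
  assumes a: "even a" "a \<ge> 4"
  defines "G \<equiv> presented_group (quasidihedral_relations a)"
    and "cl \<equiv> \<lambda>w. word_rel (quasidihedral_relations a) `` {w}"
    and "X \<equiv> cl [Gen sd_x]" and "Y \<equiv> cl [Gen sd_y]"
    and "e \<equiv> \<lambda>i b. X [^]\<^bsub>G\<^esub> i \<otimes>\<^bsub>G\<^esub> (if b then Y else \<one>\<^bsub>G\<^esub>)"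
begin

interpretation G: group G
  unfolding G_def by (rule group_presented_group)

lemma cl_eq_iff: "cl u = cl v \<longleftrightarrow> word_eq (quasidihedral_relations a) u v"
  unfolding cl_def using eq_equiv_class_iff[OF equiv_word_rel] by (simp add: word_rel_def)

lemma cl_append: "cl (u @ v) = cl u \<otimes>\<^bsub>G\<^esub> cl v"
  by (simp add: G_def cl_def presented_group_mult)

lemma cl_Nil: "cl [] = \<one>\<^bsub>G\<^esub>"
  by (simp add: G_def cl_def presented_group_def)

lemma carrier_cl: "carrier G = range cl"
  by (auto simp: G_def cl_def presented_group_def quotient_def)

lemma cl_closed [simp]: "cl w \<in> carrier G" "X \<in> carrier G" "Y \<in> carrier G"
  by (simp_all add: carrier_cl X_def Y_def)

lemma cl_Inv: "cl [Inv s] = inv\<^bsub>G\<^esub> cl [Gen s]"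
  by (rule G.inv_equality[symmetric])
    (simp_all add: cl_eq_iff word_cancel_left flip: cl_append cl_Nil)

lemma X_pow: "X [^]\<^bsub>G\<^esub> (k::nat) = cl (replicate k (Gen sd_x))"
proof (induction k)
  case (Suc k)
  then show ?case by (simp add: X_def replicate_append_same flip: cl_append)
qed (simp add: cl_Nil)

lemma cl_relation: "(u, v) \<in> quasidihedral_relations a \<Longrightarrow> cl u = cl v"
  by (simp add: cl_eq_iff word_relation)

lemma X_order: "X [^]\<^bsub>G\<^esub> (2 * int a) = \<one>\<^bsub>G\<^esub>"
  using cl_relation[of "replicate (2 * a) (Gen sd_x)" "[]"] int_pow_int[of G X "2 * a"]
  by (simp add: X_pow cl_Nil quasidihedral_relations_def)

lemma Y_square: "Y \<otimes>\<^bsub>G\<^esub> Y = \<one>\<^bsub>G\<^esub>"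
  using cl_relation[of "replicate 2 (Gen sd_y)" "[]"]
  by (simp add: Y_def cl_Nil quasidihedral_relations_def numeral_2_eq_2 flip: cl_append)

lemma Y_inv: "inv\<^bsub>G\<^esub> Y = Y"
  by (rule G.inv_equality) (simp_all add: Y_square)

text \<open>As \<open>Y\<close> is its own inverse, the third relation expresses a power of
  \<open>X\<close> as the product of \<open>Y\<close>, \<open>X\<close> and \<open>Y\<close>;
  multiplying by \<open>Y\<close> on the right gives the claim.\<close>

lemma Y_X: "Y \<otimes>\<^bsub>G\<^esub> X = X [^]\<^bsub>G\<^esub> (int a - 1) \<otimes>\<^bsub>G\<^esub> Y"
proof -
  have "cl [Inv sd_y, Gen sd_x, Gen sd_y] = cl [Inv sd_y] \<otimes>\<^bsub>G\<^esub> (X \<otimes>\<^bsub>G\<^esub> Y)"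
    by (simp add: X_def Y_def flip: cl_append)
  moreover have "cl [Inv sd_y] = Y" by (simp add: cl_Inv Y_inv flip: Y_def)
  moreover have "cl [Inv sd_y, Gen sd_x, Gen sd_y] = X [^]\<^bsub>G\<^esub> (a - 1)"
    unfolding X_pow by (rule cl_relation) (simp add: quasidihedral_relations_def)
  moreover have "X [^]\<^bsub>G\<^esub> (int a - 1) = X [^]\<^bsub>G\<^esub> (a - 1)"
    using a int_pow_int[of G X "a - 1"] by (simp add: of_nat_diff)
  ultimately have "X [^]\<^bsub>G\<^esub> (int a - 1) = Y \<otimes>\<^bsub>G\<^esub> (X \<otimes>\<^bsub>G\<^esub> Y)" by simp
  then show ?thesis by (simp add: G.m_assoc Y_square)
qed

lemma Y_X_pow: "Y \<otimes>\<^bsub>G\<^esub> X [^]\<^bsub>G\<^esub> (j::int) = X [^]\<^bsub>G\<^esub> ((int a - 1) * j) \<otimes>\<^bsub>G\<^esub> Y"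
  using G.int_pow_commute_rel[OF _ _ _ Y_X, of j] by (simp add: G.int_pow_pow)

lemma mult_normal_form:
  "e i b \<otimes>\<^bsub>G\<^esub> e j c = e (i + (if b then (int a - 1) * j else j)) (b \<noteq> c)"
proof (cases b)
  case False
  then show ?thesis by (simp add: e_def G.int_pow_mult G.m_assoc)
next
  case True
  let ?C = "if c then Y else \<one>\<^bsub>G\<^esub>"
  have "e i b \<otimes>\<^bsub>G\<^esub> e j c = X [^]\<^bsub>G\<^esub> i \<otimes>\<^bsub>G\<^esub> (Y \<otimes>\<^bsub>G\<^esub> X [^]\<^bsub>G\<^esub> j) \<otimes>\<^bsub>G\<^esub> ?C"
    using True by (simp add: e_def G.m_assoc)
  also have "\<dots> = X [^]\<^bsub>G\<^esub> (i + (int a - 1) * j) \<otimes>\<^bsub>G\<^esub> (Y \<otimes>\<^bsub>G\<^esub> ?C)"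
    by (simp add: Y_X_pow G.int_pow_mult G.m_assoc)
  also have "\<dots> = e (i + (if b then (int a - 1) * j else j)) (b \<noteq> c)"
    using True by (simp add: e_def Y_square)
  finally show ?thesis .
qed

lemma X_pow_cong:
  assumes "[i = j] (mod 2 * int a)"
  shows "X [^]\<^bsub>G\<^esub> i = X [^]\<^bsub>G\<^esub> j"
proof -
  obtain q where "i = j + 2 * int a * q" using assms by (metis cong_iff_lin cong_sym)
  then have "X [^]\<^bsub>G\<^esub> i = X [^]\<^bsub>G\<^esub> j \<otimes>\<^bsub>G\<^esub> (X [^]\<^bsub>G\<^esub> (2 * int a)) [^]\<^bsub>G\<^esub> q"
    by (simp only: G.int_pow_mult G.int_pow_pow cl_closed)
  then show ?thesis by (simp add: X_order)
qed

text \<open>Reducing the exponent to a natural number exhibits a word without inverse letters, on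
  which \<open>word_act\<close> can be evaluated.\<close>

lemma normal_form_word:
  "e i b = cl (replicate (nat (i mod (2 * int a))) (Gen sd_x) @ (if b then [Gen sd_y] else []))"
proof -
  have "X [^]\<^bsub>G\<^esub> i = X [^]\<^bsub>G\<^esub> int (nat (i mod (2 * int a)))"
    by (rule X_pow_cong) (use a in \<open>simp add: cong_def\<close>)
  also have "\<dots> = cl (replicate (nat (i mod (2 * int a))) (Gen sd_x))"
    by (simp only: int_pow_int X_pow)
  finally show ?thesis by (simp add: e_def cl_append Y_def cl_Nil)
qed

text \<open>Equal elements act by the same affine map, whose translation part recovers the index and
  whose linear part recovers the flag.\<close>

lemma normal_form_eq_iff: "e i b = e j c \<longleftrightarrow> b = c \<and> [i = j] (mod 2 * int a)"
proof
  assume "e i b = e j c"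
  then have act: "[i mod (2 * int a) + (if b then (int a - 1) * t else t)
      = j mod (2 * int a) + (if c then (int a - 1) * t else t)] (mod 2 * int a)" for t
    using word_eq_act_cong[OF a(1) _ _ cong_refl[of t]] a unfolding normal_form_word cl_eq_iff
    by (fastforce simp: add.commute)
  \<comment> \<open>At 0 only the translation part remains.\<close>
  from act[of 0] have ij: "[i = j] (mod 2 * int a)"
    by (cases b; cases c) (simp_all add: cong_def)
  moreover have "b = c"
  proof (rule ccontr)
    assume "b \<noteq> c"
    \<comment> \<open>At 1 the linear parts contribute \<open>a - 1\<close> and \<open>1\<close>;
      these differ modulo \<open>2 * a\<close> because \<open>0 < a - 2 < 2 * a\<close>.\<close>
    with act[of 1] have "[i + (int a - 1) = j + 1] (mod 2 * int a) \<or> [i + 1 = j + (int a - 1)] (mod 2 * int a)"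
      by (auto simp: cong_def mod_simps split: if_splits)
    with ij have "[int a - 1 = 1] (mod 2 * int a) \<or> [1 = int a - 1] (mod 2 * int a)"
      by (meson cong_add_lcancel cong_sym cong_trans cong_add cong_refl)
    then have "[int a - 1 = 1] (mod 2 * int a)" using cong_sym by blast
    then have "2 * int a dvd int a - 2" by (simp add: cong_iff_dvd_diff)
    then show False using zdvd_imp_le[of "2 * int a" "int a - 2"] a by simp
  qed
  ultimately show "b = c \<and> [i = j] (mod 2 * int a)" by simp
next
  assume "b = c \<and> [i = j] (mod 2 * int a)"
  then show "e i b = e j c" using X_pow_cong by (auto simp: e_def)
qed

lemma letter_normal_form: "\<exists>i b. cl [l] = e i b"
proof (cases l)
  case (Gen s)
  have "X = e 1 False" "Y = e 0 True" by (simp_all add: e_def)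
  then show ?thesis using Gen by (cases s) (auto simp flip: X_def Y_def)
next
  case (Inv s)
  have "inv\<^bsub>G\<^esub> X = e (-1) False" "inv\<^bsub>G\<^esub> Y = e 0 True" by (simp_all add: e_def Y_inv G.int_pow_neg)
  then show ?thesis using Inv by (cases s) (auto simp: cl_Inv simp flip: X_def Y_def)
qed

text \<open>Each letter has a normal form, and by \<open>mult_normal_form\<close> normal forms are
  closed under products.\<close>

lemma word_normal_form: "\<exists>i b. cl w = e i b"
proof (induction w)
  case Nil
  have "cl [] = e 0 False" by (simp add: e_def cl_Nil)
  then show ?case by blast
next
  case (Cons l w)
  obtain i b j c where "cl [l] = e i b" "cl w = e j c"
    using letter_normal_form[of l] Cons by blast
  then have "cl (l # w) = e (i + (if b then (int a - 1) * j else j)) (b \<noteq> c)"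
    using cl_append[of "[l]" w] by (simp only: append.simps mult_normal_form)
  then show ?case by blast
qed

lemma semidihedral_presented:
  assumes "m \<ge> 2" "a = 2 ^ m"
  shows "semidihedral G m (int a) e"
proof
  show "carrier G = (\<Union>i b. {e i b})"
    using word_normal_form by (auto simp: carrier_cl) (metis rangeI normal_form_word)
qed (use assms in \<open>simp_all add: mult_normal_form normal_form_eq_iff\<close>)

end

theorem theorem2p5:
  fixes n g a :: nat
  assumes "n \<ge> 4" and "g = 2 ^ n" and "a = 2 ^ (n - 2)"
  shows "f2 (quasidihedral a) = 2"
proof -
  \<comment> \<open>Writing the exponent as \<open>k + 2\<close> exposes the factor 4 of
    \<open>a\<close>.\<close>
  define k where "k = n - 4"
  have k: "n - 2 = k + 2" using assms(1) by (simp add: k_def)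
  have "even a" "a \<ge> 4" by (simp_all add: assms(3) k)
  moreover have "n - 2 \<ge> 2" using assms(1) by simp
  ultimately show ?thesis
    using semidihedral.f2_eq_2[OF semidihedral_presented] assms(3)
    by (simp add: quasidihedral_def quasidihedral_relations_def)
qed

end
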